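(* Let $\beta_{\mathrm k}>0$, let $\Gamma\in\mathbb R^{n\times n}$ be a symmetric positive definite matrix, and let $x^{(d)}\in\mathbb R^n$. The squared exponential kernel $k(\cdot,x^{(d)}):\widetilde{\mathbb X}\to\mathbb R$, $$k(x,x^{(d)}):=\beta_{\mathrm k}\exp\!\big(-(x-x^{(d)})^\top\Gamma^{-1}(x-x^{(d)})/2\big),$$ belongs to $\mathcal F(1)$, and the choices $$\underline{d^2}\big(k(\cdot,x^{(d)})\big)=-\beta_{\mathrm k}\lambda_{\max}(\Gamma^{-1}),\qquad \overline{d^2}\big(k(\cdot,x^{(d)})\big)=2\beta_{\mathrm k}\lambda_{\max}(\Gamma^{-1})\exp(-3/2)$$ satisfy the defining condition of $\mathcal F(1)$.
   Context: Let $n\in\mathbb N$, let $\mathbb X\subset\mathbb R^n$ be a bounded closed set containing the origin, and let $\widetilde{\mathbb X}\subset\mathbb R^n$ be a bounded open set containing $\mathbb X$. $\lambda_{\max}$ denotes the maximum eigenvalue of a symmetric matrix. $\mathcal F(1)$ is the set of $C^2$ functions $\xi:\widetilde{\mathbb X}\to\mathbb R$ for which there are known constants (obtainable from the form of $\xi$ and given information) $\underline{d^2}(\xi)$, $\overline{d^2}(\xi)$ with $\underline{d^2}(\xi)\le \frac{\partial^2}{\partial\chi^2}\xi(x+\chi\nu)\big|_{\chi=0}\le\overline{d^2}(\xi)$ for all $x\in\mathbb X$ and all $\nu\in\mathbb R^n$ with $\|\nu\|=1$. *)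

theory Defs
  imports "HOL-Analysis.Analysis"
begin

text \<open>Frechet formulation of being twice continuously differentiable; intended for open \<open>S\<close>.
  Existence and continuity of the first derivative follow from its differentiability.
  A function on \<open>S\<close> is represented by a total function, whose values outside \<open>S\<close> are irrelevant.\<close>

definition C2_on :: "'a::real_normed_vector set \<Rightarrow> ('a \<Rightarrow> 'b::real_normed_vector) \<Rightarrow> bool" where
  "C2_on S f \<longleftrightarrow>
     (\<exists>(f' :: 'a \<Rightarrow> 'a \<Rightarrow>\<^sub>L 'b) (f'' :: 'a \<Rightarrow> 'a \<Rightarrow>\<^sub>L ('a \<Rightarrow>\<^sub>L 'b)).
        (\<forall>x\<in>S. (f has_derivative blinfun_apply (f' x)) (at x)) \<and>
        (\<forall>x\<in>S. (f' has_derivative blinfun_apply (f'' x)) (at x)) \<and>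
        continuous_on S f'')"

text \<open>\<^const>\<open>deriv\<close> is total, so this value is meaningful only where the iterated derivative
  exists, e.g. where \<open>f\<close> is \<^const>\<open>C2_on\<close> an open neighbourhood of \<open>x\<close>.\<close>

definition dir_deriv2 :: "(real^'n \<Rightarrow> real) \<Rightarrow> real^'n \<Rightarrow> real^'n \<Rightarrow> real" where
  "dir_deriv2 f x \<nu> = (deriv ^^ 2) (\<lambda>t. f (x + t *\<^sub>R \<nu>)) 0"

definition d2_bounds :: "(real^'n) set \<Rightarrow> (real^'n \<Rightarrow> real) \<Rightarrow> real \<Rightarrow> real \<Rightarrow> bool" where
  "d2_bounds X f l u \<longleftrightarrow>
     (\<forall>x\<in>X. \<forall>\<nu>. norm \<nu> = 1 \<longrightarrow> l \<le> dir_deriv2 f x \<nu> \<and> dir_deriv2 f x \<nu> \<le> u)"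

text \<open>The class F(1) for the sets \<open>X \<subseteq> Xt\<close>. That the constants be known has no formal
  counterpart beyond their existence; a claim about specific constants is made with
  \<^const>\<open>d2_bounds\<close>.\<close>

definition F1 :: "(real^'n) set \<Rightarrow> (real^'n) set \<Rightarrow> (real^'n \<Rightarrow> real) set" where
  "F1 X Xt = {f. C2_on Xt f \<and> (\<exists>l u. d2_bounds X f l u)}"

definition sym_pos_def :: "real^'n^'n \<Rightarrow> bool" where
  "sym_pos_def A \<longleftrightarrow> transpose A = A \<and> (\<forall>v. v \<noteq> 0 \<longrightarrow> v \<bullet> (A *v v) > 0)"

definition eigenvalues :: "real^'n^'n \<Rightarrow> real set" where
  "eigenvalues A = {c. \<exists>v. v \<noteq> 0 \<and> A *v v = c *\<^sub>R v}"

text \<open>Intended for symmetric \<open>A\<close>, whose set of real eigenvalues is finite and nonempty.\<close>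

definition lambda_max :: "real^'n^'n \<Rightarrow> real" where
  "lambda_max A = Max (eigenvalues A)"

definition se_kernel :: "real \<Rightarrow> real^'n^'n \<Rightarrow> real^'n \<Rightarrow> real^'n \<Rightarrow> real" where
  "se_kernel \<beta> \<Gamma> x xd = \<beta> * exp (- ((x - xd) \<bullet> (matrix_inv \<Gamma> *v (x - xd))) / 2)"

end

theory Submission imports Defs begin

text \<open>
  Write \<open>A = \<Gamma>\<^sup>-\<^sup>1\<close>, which is again symmetric positive definite. Along the line \<open>x + t\<nu>\<close> the kernel
  is \<open>\<beta> exp (- (s + 2tb + t\<^sup>2a) / 2)\<close>, where for \<open>w = x - xd\<close> the coefficients are \<open>s = w \<bullet> Aw\<close>,
  \<open>b = w \<bullet> A\<nu>\<close> and \<open>a = \<nu> \<bullet> A\<nu>\<close>. Its second derivative at \<open>t = 0\<close> is therefore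
  \<open>\<beta> (b\<^sup>2 - a) exp (- s / 2)\<close> (lemma \<open>dir_deriv2_se_kernel\<close>).

  Two facts bound this expression. For unit vectors \<open>\<nu>\<close> definiteness and the Rayleigh quotient give
  \<open>0 \<le> a \<le> \<lambda>\<^sub>m\<^sub>a\<^sub>x(A)\<close> (lemma \<open>Rayleigh_le_lambda_max\<close>), and the Cauchy-Schwarz inequality for the form
  of \<open>A\<close> gives \<open>0 \<le> b\<^sup>2 \<le> s a\<close> (lemma \<open>psd_Cauchy_Schwarz\<close>). Dropping \<open>b\<^sup>2\<close> and using
  \<open>exp (- s / 2) \<le> 1\<close> yields the lower bound. Replacing \<open>b\<^sup>2\<close> by \<open>s a\<close> leaves
  \<open>\<beta> a (s - 1) exp (- s / 2)\<close>, and \<open>(s - 1) exp (- s / 2)\<close> has its maximum \<open>2 exp (- 3 / 2)\<close>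
  at \<open>s = 3\<close>, which yields the upper bound.

  For membership in the class it remains to exhibit the first and second Frechet derivatives
  (lemma \<open>C2_on_se_kernel\<close>): the gradient is \<open>- k(x) Aw\<close> and the Hessian
  \<open>k(x) (Aw (Aw)\<^sup>T - A)\<close>.
\<close>

section \<open>Symmetric matrices and their largest eigenvalue\<close>

text \<open>The quadratic \<open>t \<mapsto> (u + t v) \<bullet> A (u + t v)\<close> is nonnegative. The form may be degenerate, so
  this applies also to the shifted operator \<open>M I - A\<close> of the Rayleigh argument below.\<close>

lemma psd_Cauchy_Schwarz:
  fixes u v :: "'a::real_inner"
  assumes lin: "linear A" and sym: "\<And>x y. x \<bullet> A y = A x \<bullet> y" and psd: "\<And>x. 0 \<le> x \<bullet> A x"
  shows "(u \<bullet> A v)\<^sup>2 \<le> (u \<bullet> A u) * (v \<bullet> A v)"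
proof -
  define a b c where "a = u \<bullet> A u" and "b = u \<bullet> A v" and "c = v \<bullet> A v"
  have vu: "v \<bullet> A u = b"
    using sym[of v u] by (simp add: b_def inner_commute)
  have nonneg: "0 \<le> a + 2 * t * b + t\<^sup>2 * c" for t
    using psd[of "u + t *\<^sub>R v"] vu
    by (simp add: linear_add[OF lin] linear_scale[OF lin] inner_add inner_commute
        a_def b_def c_def power2_eq_square algebra_simps)
  have "b\<^sup>2 \<le> a * c"
  proof (cases "c = 0")
    case True
    \<comment> \<open>A nonnegative affine function of \<open>t\<close> has slope zero.\<close>
    have "b = 0"
    proof (rule ccontr)
      assume "b \<noteq> 0"
      then show False
        using nonneg[of "- (a + 1) / (2 * b)"] True by (simp add: field_simps)
    qed
    then show ?thesis using True by simp
  next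
    case False
    \<comment> \<open>The quadratic is evaluated at its minimiser \<open>- b / c\<close>.\<close>
    then have "0 < c" using psd[of v] by (simp add: c_def)
    then show ?thesis
      using nonneg[of "- b / c"] by (simp add: field_simps power2_eq_square)
  qed
  then show ?thesis by (simp add: a_def b_def c_def)
qed

lemma symmetric_matrix_inner:
  fixes A :: "real^'n^'n"
  assumes "transpose A = A"
  shows "x \<bullet> (A *v y) = (A *v x) \<bullet> y"
  using dot_lmul_matrix[of x A y] assms
  by (metis transpose_matrix_vector)

text \<open>Eigenvectors for different eigenvalues are orthogonal, hence linearly independent, so there
  are at most as many eigenvalues as dimensions. Finiteness is what makes the maximum in
  \<^const>\<open>lambda_max\<close> an upper bound of the eigenvalues.\<close>

lemma finite_eigenvalues:
  fixes A :: "real^'n^'n"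
  assumes "transpose A = A"
  shows "finite (eigenvalues A)"
proof -
  obtain v where v: "\<And>c. c \<in> eigenvalues A \<Longrightarrow> v c \<noteq> 0 \<and> A *v v c = c *\<^sub>R v c"
    using bchoice[of "eigenvalues A" "\<lambda>c v. v \<noteq> 0 \<and> A *v v = c *\<^sub>R v"]
    by (auto simp: eigenvalues_def)
  have orth: "v c \<bullet> v d = 0" if "c \<in> eigenvalues A" "d \<in> eigenvalues A" "c \<noteq> d" for c d
  proof -
    have "d * (v c \<bullet> v d) = c * (v c \<bullet> v d)"
      using symmetric_matrix_inner[OF assms, of "v c" "v d"] v that by simp
    then show ?thesis using that by simp
  qed
  have "inj_on v (eigenvalues A)"
    by (rule inj_onI) (metis orth v inner_eq_zero_iff)
  moreover have "pairwise orthogonal (v ` eigenvalues A)"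
    unfolding pairwise_def orthogonal_def by (metis imageE orth)
  then have "finite (v ` eigenvalues A)"
    by (intro independent_imp_finite pairwise_orthogonal_independent) (use v in force)+
  ultimately show ?thesis by (metis finite_imageD)
qed

text \<open>By compactness the form attains a maximum \<open>M\<close> on the unit sphere, at \<open>v\<close> say. Then
  \<open>B = M I - A\<close> is positive semidefinite and its form vanishes at \<open>v\<close>. By Cauchy-Schwarz
  \<open>(Bv \<bullet> Bv)\<^sup>2 \<le> (Bv \<bullet> B Bv) (v \<bullet> Bv) = 0\<close>, so \<open>Bv = 0\<close>: the maximum \<open>M\<close> is an eigenvalue.\<close>

lemma Rayleigh_le_lambda_max:
  fixes A :: "real^'n^'n"
  assumes sym: "transpose A = A" and "norm \<nu> = 1"
  shows "\<nu> \<bullet> (A *v \<nu>) \<le> lambda_max A"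
proof -
  have "continuous_on (sphere 0 1) (\<lambda>x::real^'n. x \<bullet> (A *v x))"
    by (intro continuous_intros matrix_vector_mult_linear_continuous_on)
  moreover have "\<nu> \<in> sphere 0 1"
    using assms(2) by (simp add: dist_norm)
  ultimately obtain v where nv: "norm v = 1"
      and max: "\<And>x. norm x = 1 \<Longrightarrow> x \<bullet> (A *v x) \<le> v \<bullet> (A *v v)"
    using continuous_attains_sup[OF compact_sphere, of 0 1 "\<lambda>x. x \<bullet> (A *v x)"] by auto
  define M where "M = v \<bullet> (A *v v)"
  define B where "B = (\<lambda>x. M *\<^sub>R x - A *v x)"
  have lin: "linear B"
    unfolding B_def by (intro linear_compose_sub linear_scale_self matrix_vector_mul_linear)
  have symB: "x \<bullet> B y = B x \<bullet> y" for x y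
    using symmetric_matrix_inner[OF sym, of x y] by (simp add: B_def inner_diff)
  have psd: "0 \<le> x \<bullet> B x" for x
  proof (cases "x = 0")
    case False
    have "A *v ((1 / norm x) *\<^sub>R x) = (1 / norm x) *\<^sub>R (A *v x)"
      by (simp add: matrix_vector_mult_scaleR)
    then have "x \<bullet> (A *v x) / (norm x)\<^sup>2 \<le> M"
      using max[of "(1 / norm x) *\<^sub>R x"] False
      by (simp add: M_def power2_eq_square field_simps)
    then show ?thesis
      using False by (simp add: B_def inner_diff field_simps dot_square_norm)
  qed simp
  have "v \<bullet> B v = 0"
    using nv by (simp add: B_def M_def inner_diff dot_square_norm)
  then have "B v \<bullet> B v = 0"
    using psd_Cauchy_Schwarz[OF lin symB psd, of "B v" v] by simp
  then have "A *v v = M *\<^sub>R v"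
    by (simp add: B_def)
  moreover have "v \<noteq> 0" using nv by auto
  ultimately have "M \<in> eigenvalues A"
    by (auto simp: eigenvalues_def)
  then have "M \<le> lambda_max A"
    unfolding lambda_max_def by (intro Max_ge finite_eigenvalues[OF sym])
  with max[OF assms(2)] show ?thesis by (simp add: M_def)
qed

text \<open>Substituting \<open>x = \<Gamma> (\<Gamma>\<^sup>-\<^sup>1 x)\<close> turns both symmetry and positivity of the form of \<open>\<Gamma>\<^sup>-\<^sup>1\<close> at
  \<open>x\<close> into those of \<open>\<Gamma>\<close> at \<open>\<Gamma>\<^sup>-\<^sup>1 x\<close>.\<close>

lemma sym_pos_def_matrix_inv:
  fixes \<Gamma> :: "real^'n^'n"
  assumes "sym_pos_def \<Gamma>"
  shows "sym_pos_def (matrix_inv \<Gamma>)"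
proof -
  define A where "A = matrix_inv \<Gamma>"
  have sym: "transpose \<Gamma> = \<Gamma>" and pos: "\<And>v. v \<noteq> 0 \<Longrightarrow> 0 < v \<bullet> (\<Gamma> *v v)"
    using assms by (auto simp: sym_pos_def_def)
  have "\<forall>x. \<Gamma> *v x = 0 \<longrightarrow> x = 0"
    using pos by (metis inner_zero_right less_irrefl)
  then have "invertible \<Gamma>"
    by (simp add: invertible_left_inverse matrix_left_invertible_ker)
  then have "\<Gamma> ** A = mat 1"
    unfolding invertible_def A_def matrix_inv_def by (rule someI2_ex) simp
  then have \<Gamma>A: "\<Gamma> *v (A *v x) = x" for x
    by (simp add: matrix_vector_mul_assoc)
  have "x \<bullet> (A *v y) = (A *v x) \<bullet> y" for x y
    using symmetric_matrix_inner[OF sym, of "A *v x" "A *v y"] \<Gamma>A by simp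
  then have "(transpose A *v x) \<bullet> y = (A *v x) \<bullet> y" for x y
    by (simp add: transpose_matrix_vector dot_lmul_matrix)
  then have "transpose A *v x = A *v x" for x
    using vector_eq_rdot by blast
  then have "transpose A = A"
    by (simp add: matrix_eq)
  moreover have "0 < x \<bullet> (A *v x)" if "x \<noteq> 0" for x
    using pos[of "A *v x"] \<Gamma>A[of x] that
    by (metis inner_commute matrix_vector_mult_0_right)
  ultimately show ?thesis by (simp add: sym_pos_def_def A_def)
qed

section \<open>Derivatives of the squared exponential kernel\<close>

lemma se_kernel_has_derivative:
  fixes \<Gamma> :: "real^'n^'n"
  assumes "transpose (matrix_inv \<Gamma>) = matrix_inv \<Gamma>"
  shows "((\<lambda>x. se_kernel \<beta> \<Gamma> x xd) has_derivative
    (\<lambda>h. - se_kernel \<beta> \<Gamma> x xd * ((matrix_inv \<Gamma> *v (x - xd)) \<bullet> h))) (at x)"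
proof -
  define A where "A = matrix_inv \<Gamma>"
  define w where "w = (\<lambda>x. x - xd)"
  have w: "(w has_derivative (\<lambda>h. h)) (at x)"
    unfolding w_def by (auto intro!: derivative_eq_intros)
  have Aw: "((\<lambda>x. A *v w x) has_derivative (\<lambda>h. A *v h)) (at x)"
    by (rule bounded_linear.has_derivative[OF matrix_vector_mul_bounded_linear w])
  have "w x \<bullet> (A *v h) + h \<bullet> (A *v w x) = 2 * ((A *v w x) \<bullet> h)" for h
    using symmetric_matrix_inner[of A "w x" h] assms by (simp add: A_def inner_commute)
  moreover define q where "q = (\<lambda>x. w x \<bullet> (A *v w x))"
  ultimately have q: "(q has_derivative (\<lambda>h. 2 * ((A *v w x) \<bullet> h))) (at x)"
    using has_derivative_inner[OF w Aw] by simp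
  have "((\<lambda>x. \<beta> * exp (- q x / 2)) has_derivative
      (\<lambda>h. - (\<beta> * exp (- q x / 2)) * ((A *v w x) \<bullet> h))) (at x)"
    by (auto intro!: derivative_eq_intros q)
  then show ?thesis
    unfolding se_kernel_def q_def w_def A_def .
qed

text \<open>Both derivatives have to be given as bounded linear maps. With the Riesz embedding \<open>J\<close>, which
  sends a vector \<open>y\<close> to the functional \<open>h \<mapsto> y \<bullet> h\<close>, the first derivative is \<open>J\<close> applied to the
  gradient, and the second is \<open>J\<close> composed with the Hessian. Continuity of the Hessian as an
  operator is then inherited from that of \<open>k\<close> and of \<open>g(x) = A (x - xd)\<close>.\<close>

lemma C2_on_se_kernel:
  fixes \<Gamma> :: "real^'n^'n"
  assumes "transpose (matrix_inv \<Gamma>) = matrix_inv \<Gamma>"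
  shows "C2_on S (\<lambda>x. se_kernel \<beta> \<Gamma> x xd)"
proof -
  define A where "A = matrix_inv \<Gamma>"
  define k where "k = (\<lambda>x. se_kernel \<beta> \<Gamma> x xd)"
  define J :: "(real^'n) \<Rightarrow>\<^sub>L ((real^'n) \<Rightarrow>\<^sub>L real)" where "J = Blinfun blinfun_inner_right"
  define L :: "(real^'n) \<Rightarrow>\<^sub>L (real^'n)" where "L = Blinfun ((*v) A)"
  have J: "blinfun_apply J = blinfun_inner_right"
    unfolding J_def by (rule bounded_linear_Blinfun_apply) (rule bounded_linear_blinfun_inner_right)
  have L: "blinfun_apply L = (*v) A"
    unfolding L_def by (rule bounded_linear_Blinfun_apply) (rule matrix_vector_mul_bounded_linear)
  define g where "g = (\<lambda>x. A *v (x - xd))"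
  define k' where "k' = (\<lambda>x. J (- k x *\<^sub>R g x))"
  define k'' where "k'' = (\<lambda>x. J o\<^sub>L (k x *\<^sub>R ((blinfun_scaleR_left (g x) o\<^sub>L blinfun_inner_right (g x)) - L)))"
  have k: "(k has_derivative (\<lambda>h. - k x * (g x \<bullet> h))) (at x)" for x
    unfolding k_def g_def A_def by (rule se_kernel_has_derivative[OF assms])
  have g: "(g has_derivative (\<lambda>h. A *v h)) (at x)" for x
    unfolding g_def
    by (auto intro!: derivative_eq_intros bounded_linear.has_derivative[OF matrix_vector_mul_bounded_linear])
  have "(k has_derivative blinfun_apply (k' x)) (at x)" for x
    by (rule has_derivative_eq_rhs[OF k]) (simp add: k'_def J fun_eq_iff)
  moreover have "(k' has_derivative blinfun_apply (k'' x)) (at x)" for x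
    unfolding k'_def
    by (rule has_derivative_eq_rhs, (rule derivative_intros k g)+)
       (auto simp: k''_def L fun_eq_iff blinfun.bilinear_simps algebra_simps intro!: arg_cong[where f = "blinfun_apply J"])
  moreover have "continuous_on S k''"
  proof -
    have contk: "continuous_on S k"
      by (intro continuous_at_imp_continuous_on ballI has_derivative_continuous[OF k])
    have contg: "continuous_on S g"
      by (intro continuous_at_imp_continuous_on ballI has_derivative_continuous[OF g])
    show ?thesis
      unfolding k''_def
      by (intro continuous_intros contk
          bounded_linear.continuous_on[OF bounded_linear_blinfun_scaleR_left contg]
          bounded_linear.continuous_on[OF bounded_linear_blinfun_inner_right contg])
  qed
  ultimately show ?thesis unfolding C2_on_def k_def by blast
qed

lemma dir_deriv2_se_kernel:
  fixes \<Gamma> :: "real^'n^'n" and x xd \<nu> :: "real^'n"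
  defines "A \<equiv> matrix_inv \<Gamma>" and "w \<equiv> x - xd"
  assumes sym: "transpose A = A"
  shows "dir_deriv2 (\<lambda>x. se_kernel \<beta> \<Gamma> x xd) x \<nu> =
    \<beta> * ((w \<bullet> (A *v \<nu>))\<^sup>2 - \<nu> \<bullet> (A *v \<nu>)) * exp (- (w \<bullet> (A *v w)) / 2)"
proof -
  define a b s where "a = \<nu> \<bullet> (A *v \<nu>)" and "b = w \<bullet> (A *v \<nu>)" and "s = w \<bullet> (A *v w)"
  define \<phi> where "\<phi> = (\<lambda>t. \<beta> * exp (- (s + 2 * t * b + t\<^sup>2 * a) / 2))"
  have "\<nu> \<bullet> (A *v w) = b"
    using symmetric_matrix_inner[OF sym, of \<nu> w] by (simp add: b_def inner_commute)
  moreover have "x + t *\<^sub>R \<nu> - xd = w + t *\<^sub>R \<nu>" for t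
    by (simp add: w_def)
  ultimately have restr: "se_kernel \<beta> \<Gamma> (x + t *\<^sub>R \<nu>) xd = \<phi> t" for t
    unfolding se_kernel_def \<phi>_def A_def[symmetric]
    by (simp add: matrix_vector_right_distrib matrix_vector_mult_scaleR inner_add a_def b_def s_def
        power2_eq_square algebra_simps)
  have d: "(\<phi> has_field_derivative - (b + t * a) * \<phi> t) (at t)" for t
    unfolding \<phi>_def by (auto intro!: derivative_eq_intros simp: field_simps)
  have "((\<lambda>t. - (b + t * a) * \<phi> t) has_field_derivative (b\<^sup>2 - a) * \<phi> 0) (at 0)"
    by (auto intro!: derivative_eq_intros d simp: power2_eq_square algebra_simps)
  moreover have "deriv \<phi> = (\<lambda>t. - (b + t * a) * \<phi> t)"
    using DERIV_imp_deriv[OF d] by blast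
  ultimately have "(deriv ^^ 2) \<phi> 0 = (b\<^sup>2 - a) * \<phi> 0"
    by (simp add: numeral_2_eq_2 DERIV_imp_deriv)
  then show ?thesis
    unfolding dir_deriv2_def restr by (simp add: \<phi>_def a_def b_def s_def)
qed

section \<open>The curvature bounds\<close>

text \<open>With \<open>0 \<le> a \<le> \<lambda>\<^sub>m\<^sub>a\<^sub>x(A)\<close> and \<open>0 \<le> b\<^sup>2 \<le> s a\<close>, everything reduces to one-variable estimates of
  \<open>exp (- s / 2)\<close> and \<open>(s - 1) exp (- s / 2)\<close> for \<open>s \<ge> 0\<close>.\<close>

lemma d2_bounds_se_kernel:
  fixes \<Gamma> :: "real^'n^'n"
  assumes "0 \<le> \<beta>" and "sym_pos_def \<Gamma>"
  shows "d2_bounds X (\<lambda>x. se_kernel \<beta> \<Gamma> x xd)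
    (- \<beta> * lambda_max (matrix_inv \<Gamma>)) (2 * \<beta> * lambda_max (matrix_inv \<Gamma>) * exp (- 3 / 2))"
proof -
  define A where "A = matrix_inv \<Gamma>"
  have sym: "transpose A = A" and psd: "0 \<le> v \<bullet> (A *v v)" for v
    using sym_pos_def_matrix_inv[OF assms(2)] unfolding A_def sym_pos_def_def
    by (auto, metis inner_zero_left less_eq_real_def)
  have "- \<beta> * lambda_max A \<le> dir_deriv2 (\<lambda>x. se_kernel \<beta> \<Gamma> x xd) x \<nu> \<and>
      dir_deriv2 (\<lambda>x. se_kernel \<beta> \<Gamma> x xd) x \<nu> \<le> 2 * \<beta> * lambda_max A * exp (- 3 / 2)"
    if \<nu>: "norm \<nu> = 1" for x \<nu>
  proof -
    define w where "w = x - xd"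
    define a b s where "a = \<nu> \<bullet> (A *v \<nu>)" and "b = w \<bullet> (A *v \<nu>)" and "s = w \<bullet> (A *v w)"
    have second: "dir_deriv2 (\<lambda>x. se_kernel \<beta> \<Gamma> x xd) x \<nu> = \<beta> * ((b\<^sup>2 - a) * exp (- s / 2))"
      using dir_deriv2_se_kernel[OF sym[unfolded A_def], of \<beta> xd x \<nu>]
      by (simp add: a_def b_def s_def w_def A_def)
    have a: "0 \<le> a" "a \<le> lambda_max A" and s: "0 \<le> s"
      using psd Rayleigh_le_lambda_max[OF sym \<nu>] by (simp_all add: a_def s_def)
    have b: "b\<^sup>2 \<le> s * a"
      unfolding a_def b_def s_def
      by (rule psd_Cauchy_Schwarz[OF matrix_vector_mul_linear symmetric_matrix_inner[OF sym] psd])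
    have "- lambda_max A \<le> - a * exp (- s / 2)"
      using a s mult_left_le[of "exp (- s / 2)" a] by simp
    also have "\<dots> \<le> (b\<^sup>2 - a) * exp (- s / 2)"
      by (intro mult_right_mono) auto
    finally have lower: "- lambda_max A \<le> (b\<^sup>2 - a) * exp (- s / 2)" .
    \<comment> \<open>\<open>(s - 1) exp (- s / 2)\<close> is largest at \<open>s = 3\<close>; convexity of \<open>exp\<close>, as
      \<open>1 + y \<le> exp y\<close> at \<open>y = (s - 3) / 2\<close>, gives the value there as a bound.\<close>
    have "(s - 1) / 2 \<le> exp ((s - 3) / 2)"
      using exp_ge_add_one_self[of "(s - 3) / 2"] by (simp add: field_simps)
    then have "(s - 1) * exp (- s / 2) \<le> 2 * exp ((s - 3) / 2) * exp (- s / 2)"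
      by (intro mult_right_mono) auto
    also have "\<dots> = 2 * exp (- 3 / 2)"
      by (simp add: field_simps flip: exp_add)
    finally have peak: "(s - 1) * exp (- s / 2) \<le> 2 * exp (- 3 / 2)" .
    have "(b\<^sup>2 - a) * exp (- s / 2) \<le> (a * (s - 1)) * exp (- s / 2)"
      using b by (intro mult_right_mono) (auto simp: algebra_simps)
    also have "\<dots> \<le> a * (2 * exp (- 3 / 2))"
      using mult_left_mono[OF peak a(1)] by (simp add: mult.assoc)
    also have "\<dots> \<le> lambda_max A * (2 * exp (- 3 / 2))"
      using a by (intro mult_right_mono) auto
    finally have upper: "(b\<^sup>2 - a) * exp (- s / 2) \<le> lambda_max A * (2 * exp (- 3 / 2))" .
    show ?thesis
      unfolding second
      using mult_left_mono[OF lower assms(1)] mult_left_mono[OF upper assms(1)]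
      by (simp add: algebra_simps)
  qed
  then show ?thesis unfolding d2_bounds_def A_def by blast
qed

theorem theorem4:
  fixes X Xt :: "(real^'n) set" and \<beta> :: real and \<Gamma> :: "real^'n^'n" and xd :: "real^'n"
  assumes "bounded X" and "closed X" and "0 \<in> X"
    and "bounded Xt" and "open Xt" and "X \<subseteq> Xt"
    and "\<beta> > 0" and "sym_pos_def \<Gamma>"
  shows "(\<lambda>x. se_kernel \<beta> \<Gamma> x xd) \<in> F1 X Xt
    \<and> d2_bounds X (\<lambda>x. se_kernel \<beta> \<Gamma> x xd)
        (- \<beta> * lambda_max (matrix_inv \<Gamma>))
        (2 * \<beta> * lambda_max (matrix_inv \<Gamma>) * exp (- 3 / 2))"
proof -
  have "transpose (matrix_inv \<Gamma>) = matrix_inv \<Gamma>"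
    using sym_pos_def_matrix_inv[OF assms(8)] by (simp add: sym_pos_def_def)
  then show ?thesis
    using C2_on_se_kernel d2_bounds_se_kernel[OF less_imp_le[OF assms(7)] assms(8)]
    unfolding F1_def by blast
qed

end
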